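(* Consider the two-agent limited-commitment risk-sharing model described in the context, with endowment process $\{y_t\}$ a time-homogeneous Markov chain on the finite set $\mathcal{Y}$ with $p(y,y^+)>0$ for all $y,y^+\in\mathcal{Y}$, and efficient consumption of agent 1 evolving by $c_{t+1}=f(c_t,z_t)$, $z_t:=y_{t+1}$, where $$f(c,z)=\begin{cases}\overline{c}_z & \text{if } c>\overline{c}_z,\\ c & \text{if } c\in I_z=[\underline{c}_z,\overline{c}_z],\\ \underline{c}_z & \text{if } c<\underline{c}_z.\end{cases}$$ Let $c_{\min}:=\min_z\overline{c}_z$ and $c_{\max}:=\max_z\underline{c}_z$. If the first-best is not sustainable, i.e. $\bigcap_z I_z=\emptyset$ (so that $c_{\min}<c_{\max}$), then there exists a unique probability distribution $\pi$ such that the distributions of $c_t$ converge to $\pi$ in the uniform metric as $t\to\infty$ for any initial value $c_0\in[c_{\min},c_{\max}]$.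
   Context: Model. Two infinitely-lived risk-averse agents have a common strictly concave differentiable per-period utility function $u:\mathbb{R}_+\to\mathbb{R}$ over consumption and a common discount factor $\beta$. At each date $t=0,1,\ldots$ agent 1 has endowment $y_t>0$ and agent 2 has endowment $Y-y_t>0$, with $Y>0$ constant. The endowment $y_t$ takes values in a finite set $\mathcal{Y}=\{y^1,\ldots,y^n\}$, $n\ge 2$, with transition probabilities $p(y,y^+)=\mathbf{P}(y_{t+1}=y^+\mid y_t=y)$. With $h^t=(y_0,\ldots,y_t)$, agents choose history-dependent transfers $X_t(h^t)$ from agent 1 to agent 2 with $-Y+y_t\le X_t(h^t)\le y_t$, subject to the self-enforcing constraints, for each $t$ and $h^t$, $$u(y_t-X_t(h^t))+\mathbf{E}\Bigl[\sum_{s\ge1}\beta^su(y_{t+s}-X_{t+s}(h^{t+s}))\Bigr]\ge u(y_t)+\mathbf{E}\Bigl[\sum_{s\ge1}\beta^su(y_{t+s})\Bigr],$$ $$u(Y-y_t+X_t(h^t))+\mathbf{E}\Bigl[\sum_{s\ge1}\beta^su(Y-y_{t+s}+X_{t+s}(h^{t+s}))\Bigr]\ge u(Y-y_t)+\mathbf{E}\Bigl[\sum_{s\ge1}\beta^su(Y-y_{t+s})\Bigr]$$ (expectations conditional on $h^t$). An efficient risk-sharing arrangement maximizes $\mathbf{E}[\sum_{s\ge0}\beta^su(y_s-X_s(h^s))]$ subject to these constraints and $\mathbf{E}[\sum_{s\ge0}\beta^su(Y-y_s+X_s(h^s))]\ge U^0$ for some feasible $U^0$. Known property of the solution (taken as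 given): for each $y\in\mathcal{Y}$ there is a time-invariant interval $I_y=[\underline{c}_y,\overline{c}_y]$, $\underline{c}_y\le\overline{c}_y$, such that agent 1's consumption $c_t(h^t):=y_t-X_t(h^t)$ satisfies $c_{t+1}=\overline{c}_{y_{t+1}}$ if $c_t>\overline{c}_{y_{t+1}}$, $c_{t+1}=c_t$ if $c_t\in I_{y_{t+1}}$, and $c_{t+1}=\underline{c}_{y_{t+1}}$ if $c_t<\underline{c}_{y_{t+1}}$. The first-best risk-sharing allocation is sustainable for some $U^0$ if and only if $\bigcap_z I_z\neq\emptyset$ (the intersection over $z\in\mathcal{Y}$). Uniform metric between distributions on the real line with distribution functions $F,G$: $d(F,G)=\sup_x|F(x)-G(x)|$. *)

theory Defs
  imports "HOL-Probability.Probability"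
begin

text \<open>The history \<open>h\<^sup>t = (y\<^sub>0, \<dots>, y\<^sub>t)\<close> is a list of length \<open>t + 1\<close>; its last entry is the current
  endowment of agent 1.\<close>

definition history :: "(nat \<Rightarrow> 'a \<Rightarrow> real) \<Rightarrow> nat \<Rightarrow> 'a \<Rightarrow> real list" where
  "history y t \<omega> = map (\<lambda>i. y i \<omega>) [0..<Suc t]"

definition history_event :: "'a measure \<Rightarrow> (nat \<Rightarrow> 'a \<Rightarrow> real) \<Rightarrow> real list \<Rightarrow> 'a set" where
  "history_event M y h = {\<omega> \<in> space M. history y (length h - 1) \<omega> = h}"

text \<open>Histories of positive probability; only on these are conditional expectations given
  \<open>h\<^sup>t\<close> determined. The law of \<open>y\<^sub>0\<close> is arbitrary, so it need not charge all states.\<close>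

definition possible_history :: "'a measure \<Rightarrow> (nat \<Rightarrow> 'a \<Rightarrow> real) \<Rightarrow> real list \<Rightarrow> bool" where
  "possible_history M y h \<longleftrightarrow> h \<noteq> [] \<and> measure M (history_event M y h) > 0"

definition markov_chain ::
  "'a measure \<Rightarrow> real set \<Rightarrow> (real \<Rightarrow> real \<Rightarrow> real) \<Rightarrow> (nat \<Rightarrow> 'a \<Rightarrow> real) \<Rightarrow> bool" where
  "markov_chain M S p y \<longleftrightarrow>
     prob_space M \<and>
     (\<forall>t. y t \<in> measurable M (count_space S)) \<and>
     (\<forall>h. \<forall>z\<in>S. possible_history M y h \<longrightarrow>
        \<P>(\<omega> in M. y (length h) \<omega> = z \<bar> history y (length h - 1) \<omega> = h) = p (last h) z)"

definition strictly_concave_on :: "real set \<Rightarrow> (real \<Rightarrow> real) \<Rightarrow> bool" where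
  "strictly_concave_on A u \<longleftrightarrow> convex A \<and>
     (\<forall>a\<in>A. \<forall>b\<in>A. \<forall>r. a \<noteq> b \<and> 0 < r \<and> r < 1 \<longrightarrow>
        u ((1 - r) * a + r * b) > (1 - r) * u a + r * u b)"

definition risk_sharing_model ::
  "'a measure \<Rightarrow> real set \<Rightarrow> (real \<Rightarrow> real \<Rightarrow> real) \<Rightarrow> (nat \<Rightarrow> 'a \<Rightarrow> real) \<Rightarrow>
   (real \<Rightarrow> real) \<Rightarrow> real \<Rightarrow> real \<Rightarrow> bool" where
  "risk_sharing_model M S p y u \<beta> Y \<longleftrightarrow>
     strictly_concave_on {0..} u \<and> u differentiable_on {0..} \<and>
     0 < \<beta> \<and> \<beta> < 1 \<and>
     finite S \<and> card S \<ge> 2 \<and> (\<forall>e\<in>S. 0 < e \<and> 0 < Y - e) \<and>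
     markov_chain M S p y"

text \<open>A plan of transfers from agent 1 to agent 2 is a function \<open>X\<close> of histories; the date is
  the length of the history minus one.\<close>

definition utility1 :: "(real \<Rightarrow> real) \<Rightarrow> (real list \<Rightarrow> real) \<Rightarrow> real list \<Rightarrow> real" where
  "utility1 u X h = u (last h - X h)"

definition utility2 :: "(real \<Rightarrow> real) \<Rightarrow> real \<Rightarrow> (real list \<Rightarrow> real) \<Rightarrow> real list \<Rightarrow> real" where
  "utility2 u Y X h = u (Y - last h + X h)"

definition ex_ante_value ::
  "'a measure \<Rightarrow> (nat \<Rightarrow> 'a \<Rightarrow> real) \<Rightarrow> real \<Rightarrow> (real list \<Rightarrow> real) \<Rightarrow> real" where
  "ex_ante_value M y \<beta> v = (LINT \<omega>|M. (\<Sum>s. \<beta> ^ s * v (history y s \<omega>)))"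

text \<open>\<open>v(h\<^sup>t) + E[\<Sum>\<^sub>s\<^sub>\<ge>\<^sub>1 \<beta>\<^sup>s v(h\<^sup>t\<^sup>+\<^sup>s) | h\<^sup>t]\<close>: with \<open>h\<close> of length \<open>t + 1\<close>, the summand
  of index \<open>s\<close> below belongs to date \<open>t + (s + 1) = length h + s\<close>.\<close>

definition value_at ::
  "'a measure \<Rightarrow> (nat \<Rightarrow> 'a \<Rightarrow> real) \<Rightarrow> real \<Rightarrow> (real list \<Rightarrow> real) \<Rightarrow> real list \<Rightarrow> real" where
  "value_at M y \<beta> v h = v h +
     (LINT \<omega>|uniform_measure M (history_event M y h).
        (\<Sum>s. \<beta> ^ Suc s * v (history y (length h + s) \<omega>)))"

definition transfer_plan :: "real set \<Rightarrow> real \<Rightarrow> (real list \<Rightarrow> real) \<Rightarrow> bool" where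
  "transfer_plan S Y X \<longleftrightarrow>
     (\<forall>h. h \<noteq> [] \<and> set h \<subseteq> S \<longrightarrow> - Y + last h \<le> X h \<and> X h \<le> last h)"

text \<open>Autarky is the plan with zero transfers.\<close>

definition self_enforcing ::
  "'a measure \<Rightarrow> (nat \<Rightarrow> 'a \<Rightarrow> real) \<Rightarrow> (real \<Rightarrow> real) \<Rightarrow> real \<Rightarrow> real \<Rightarrow>
   (real list \<Rightarrow> real) \<Rightarrow> bool" where
  "self_enforcing M y u \<beta> Y X \<longleftrightarrow>
     (\<forall>h. possible_history M y h \<longrightarrow>
        value_at M y \<beta> (utility1 u X) h \<ge> value_at M y \<beta> (utility1 u (\<lambda>_. 0)) h \<and>
        value_at M y \<beta> (utility2 u Y X) h \<ge> value_at M y \<beta> (utility2 u Y (\<lambda>_. 0)) h)"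

definition optimal_in ::
  "(real list \<Rightarrow> real) set \<Rightarrow> 'a measure \<Rightarrow> (nat \<Rightarrow> 'a \<Rightarrow> real) \<Rightarrow> (real \<Rightarrow> real) \<Rightarrow> real \<Rightarrow> real \<Rightarrow>
   real \<Rightarrow> (real list \<Rightarrow> real) \<Rightarrow> bool" where
  "optimal_in \<X> M y u \<beta> Y U0 X \<longleftrightarrow>
     X \<in> \<X> \<and> ex_ante_value M y \<beta> (utility2 u Y X) \<ge> U0 \<and>
     (\<forall>X'\<in>\<X>. ex_ante_value M y \<beta> (utility2 u Y X') \<ge> U0 \<longrightarrow>
        ex_ante_value M y \<beta> (utility1 u X') \<le> ex_ante_value M y \<beta> (utility1 u X))"

definition efficient_arrangement ::
  "'a measure \<Rightarrow> real set \<Rightarrow> (nat \<Rightarrow> 'a \<Rightarrow> real) \<Rightarrow> (real \<Rightarrow> real) \<Rightarrow> real \<Rightarrow> real \<Rightarrow>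
   real \<Rightarrow> (real list \<Rightarrow> real) \<Rightarrow> bool" where
  "efficient_arrangement M S y u \<beta> Y =
     optimal_in {X. transfer_plan S Y X \<and> self_enforcing M y u \<beta> Y X} M y u \<beta> Y"

text \<open>First-best: the same problem without the self-enforcing constraints.\<close>

definition first_best_allocation ::
  "'a measure \<Rightarrow> real set \<Rightarrow> (nat \<Rightarrow> 'a \<Rightarrow> real) \<Rightarrow> (real \<Rightarrow> real) \<Rightarrow> real \<Rightarrow> real \<Rightarrow>
   real \<Rightarrow> (real list \<Rightarrow> real) \<Rightarrow> bool" where
  "first_best_allocation M S y u \<beta> Y =
     optimal_in {X. transfer_plan S Y X} M y u \<beta> Y"

definition first_best_sustainable ::
  "'a measure \<Rightarrow> real set \<Rightarrow> (nat \<Rightarrow> 'a \<Rightarrow> real) \<Rightarrow> (real \<Rightarrow> real) \<Rightarrow> real \<Rightarrow> real \<Rightarrow> bool" where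
  "first_best_sustainable M S y u \<beta> Y \<longleftrightarrow>
     (\<exists>U0 X. first_best_allocation M S y u \<beta> Y U0 X \<and> self_enforcing M y u \<beta> Y X)"

definition next_consumption ::
  "(real \<Rightarrow> real) \<Rightarrow> (real \<Rightarrow> real) \<Rightarrow> real \<Rightarrow> real \<Rightarrow> real" where
  "next_consumption lo hi c z =
     (if c > hi z then hi z else if c < lo z then lo z else c)"

text \<open>The known property of the solution: \<open>[lo z, hi z]\<close> are the time-invariant intervals
  governing agent 1's consumption \<open>y\<^sub>t - X\<^sub>t(h\<^sup>t)\<close> in efficient arrangements, and the first-best
  is sustainable iff they have a common point.\<close>

definition solution_intervals ::
  "'a measure \<Rightarrow> real set \<Rightarrow> (nat \<Rightarrow> 'a \<Rightarrow> real) \<Rightarrow> (real \<Rightarrow> real) \<Rightarrow> real \<Rightarrow> real \<Rightarrow>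
   (real \<Rightarrow> real) \<Rightarrow> (real \<Rightarrow> real) \<Rightarrow> bool" where
  "solution_intervals M S y u \<beta> Y lo hi \<longleftrightarrow>
     (\<forall>z\<in>S. lo z \<le> hi z) \<and>
     (\<forall>U0 X h z. efficient_arrangement M S y u \<beta> Y U0 X \<and>
        h \<noteq> [] \<and> possible_history M y (h @ [z]) \<longrightarrow>
        z - X (h @ [z]) = next_consumption lo hi (last h - X h) z) \<and>
     (first_best_sustainable M S y u \<beta> Y \<longleftrightarrow> (\<Inter>z\<in>S. {lo z..hi z}) \<noteq> {})"

primrec consumption ::
  "(real \<Rightarrow> real) \<Rightarrow> (real \<Rightarrow> real) \<Rightarrow> (nat \<Rightarrow> 'a \<Rightarrow> real) \<Rightarrow> real \<Rightarrow> nat \<Rightarrow> 'a \<Rightarrow> real" where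
  "consumption lo hi y c0 0 \<omega> = c0"
| "consumption lo hi y c0 (Suc t) \<omega> =
     next_consumption lo hi (consumption lo hi y c0 t \<omega>) (y (Suc t) \<omega>)"

definition uniform_metric :: "real measure \<Rightarrow> real measure \<Rightarrow> real" where
  "uniform_metric \<mu> \<nu> = (SUP x. \<bar>cdf \<mu> x - cdf \<nu> x\<bar>)"

end

theory Submission
  imports Defs
begin

text \<open>The proof is a regeneration argument carried out on test functions. Let \<open>f\<close> be the
  consumption rule, \<open>K = [c_min, c_max]\<close>, and let \<open>z\<^sub>0\<close> be an endowment whose interval has the
  smallest upper end, \<open>hi z\<^sub>0 = c_min\<close>. The rule \<open>f\<close> maps \<open>K\<close> into itself, and every consumption
  level in \<open>K\<close> lies at or above the interval of \<open>z\<^sub>0\<close>, so a single visit to \<open>z\<^sub>0\<close> sends consumption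
  to \<open>c_min\<close> whatever it was before. Such a visit happens with conditional probability at least
  \<open>\<delta> = min\<^sub>e p(e, z\<^sub>0) > 0\<close> at every date, so the pair \<open>(c\<^sub>t, y\<^sub>t)\<close> satisfies Doeblin's condition in one
  step.

  Dually, the one-step expectation operator \<open>(T g)(c, e) = \<Sum>\<^sub>z p(e, z) g(f(c, z), z)\<close> shrinks the
  oscillation of a function on \<open>K \<times> S\<close> by the factor \<open>1 - \<delta>\<close>
  (\<open>expected_next_contracts\<close>), and the Markov property gives
  \<open>E g(c\<^sub>t, y\<^sub>t) = E (T\<^sup>t g)(c\<^sub>0, y\<^sub>0)\<close> (\<open>expectation_consumption\<close>). For \<open>g\<close> the indicator of
  \<open>{c. c \<le> x}\<close> the left side is the distribution function of \<open>c\<^sub>t\<close> at \<open>x\<close>. Hence the distribution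
  functions at all dates from \<open>N\<close> on, for all initial values in \<open>K\<close>, are within \<open>(1 - \<delta>)\<^sup>N\<close> of
  each other, uniformly in \<open>x\<close> (\<open>cdf_consumption_close\<close>). Since distribution
  functions are closed under uniform limits, this Cauchy property yields the common limit and its
  uniqueness (\<open>common_uniform_limit\<close>). Working with \<open>T\<close> instead of with the law of
  \<open>(c\<^sub>t, y\<^sub>t)\<close> lets all initial values be treated at once on the infinite set \<open>K \<times> S\<close>.\<close>

section \<open>Uniform limits of distribution functions\<close>

lemma abs_cdf_diff_le_1:
  assumes "real_distribution \<mu>" "real_distribution \<nu>"
  shows "\<bar>cdf \<mu> x - cdf \<nu> x\<bar> \<le> 1"
proof -
  interpret \<mu>: real_distribution \<mu> by fact
  interpret \<nu>: real_distribution \<nu> by fact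
  show ?thesis
    using \<mu>.cdf_nonneg[of x] \<mu>.cdf_bounded_prob[of x] \<nu>.cdf_nonneg[of x] \<nu>.cdf_bounded_prob[of x]
    by linarith
qed

lemma abs_cdf_diff_le_uniform_metric:
  assumes "real_distribution \<mu>" "real_distribution \<nu>"
  shows "\<bar>cdf \<mu> x - cdf \<nu> x\<bar> \<le> uniform_metric \<mu> \<nu>"
  unfolding uniform_metric_def
  by (rule cSUP_upper2[OF _ UNIV_I order_refl])
     (auto intro!: bdd_aboveI2[where M=1] abs_cdf_diff_le_1[OF assms])

lemma uniform_metric_le:
  assumes "\<And>x. \<bar>cdf \<mu> x - cdf \<nu> x\<bar> \<le> r"
  shows "uniform_metric \<mu> \<nu> \<le> r"
  unfolding uniform_metric_def by (rule cSUP_least) (use assms in auto)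

lemma uniform_metric_nonneg:
  assumes "real_distribution \<mu>" "real_distribution \<nu>"
  shows "0 \<le> uniform_metric \<mu> \<nu>"
  using abs_cdf_diff_le_uniform_metric[OF assms, of 0] by linarith

text \<open>Uniform convergence is what keeps the limit a distribution function: it allows the limit in
  \<open>n\<close> to be exchanged with the one-sided limits and with the limits at infinity. Pointwise limits may
  lose mass at infinity or right continuity.\<close>

lemma uniform_limit_of_cdfs:
  assumes dist: "\<And>n. real_distribution (\<mu> n)"
    and lim: "uniform_limit UNIV (\<lambda>n. cdf (\<mu> n)) F sequentially"
  shows "\<exists>\<pi>. real_distribution \<pi> \<and> cdf \<pi> = F"
proof -
  have pointwise: "(\<lambda>n. cdf (\<mu> n) x) \<longlonglongrightarrow> F x" for x
    by (rule tendsto_uniform_limitI[OF lim]) simp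
  have mono: "F x \<le> F y" if "x \<le> y" for x y
    by (rule LIMSEQ_le[OF pointwise pointwise])
       (use that in \<open>auto intro!: exI[of _ 0] finite_borel_measure.cdf_nondecreasing
          real_distribution.finite_borel_measure_M dist\<close>)
  have right: "continuous (at_right a) F" for a
    unfolding continuous_within
    by (rule swap_uniform_limit'[OF _ pointwise lim])
       (auto intro!: always_eventually simp flip: continuous_within
         intro: finite_borel_measure.cdf_is_right_cont real_distribution.finite_borel_measure_M dist)
  have bot: "(F \<longlongrightarrow> 0) at_bot"
    by (rule swap_uniform_limit'[OF _ tendsto_const lim])
       (auto intro!: always_eventually finite_borel_measure.cdf_lim_at_bot
          real_distribution.finite_borel_measure_M dist)
  have top: "(F \<longlongrightarrow> 1) at_top"
    by (rule swap_uniform_limit'[OF _ tendsto_const lim])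
       (auto intro!: always_eventually real_distribution.cdf_lim_at_top_prob dist)
  show ?thesis
    using real_distribution_interval_measure[of F, OF mono right bot top]
      cdf_interval_measure[of F, OF mono right bot] by blast
qed

text \<open>Completeness of the uniform metric, for a family of sequences that are Cauchy jointly and not
  only one by one; the joint bound is what makes the limit the same for all of them.\<close>

lemma common_uniform_limit:
  fixes \<mu> :: "'i \<Rightarrow> nat \<Rightarrow> real measure" and r :: "nat \<Rightarrow> real"
  assumes "I \<noteq> {}"
    and dist: "\<And>i t. i \<in> I \<Longrightarrow> real_distribution (\<mu> i t)"
    and close: "\<And>N i j s t x. i \<in> I \<Longrightarrow> j \<in> I \<Longrightarrow> N \<le> s \<Longrightarrow> N \<le> t \<Longrightarrow>
      \<bar>cdf (\<mu> i s) x - cdf (\<mu> j t) x\<bar> \<le> r N"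
    and r: "r \<longlonglongrightarrow> 0"
  shows "\<exists>!\<pi>. real_distribution \<pi> \<and> (\<forall>i\<in>I. (\<lambda>t. uniform_metric (\<mu> i t) \<pi>) \<longlonglongrightarrow> 0)"
proof -
  obtain k where k: "k \<in> I" using \<open>I \<noteq> {}\<close> by blast
  have "uniformly_Cauchy_on UNIV (\<lambda>n. cdf (\<mu> k n))"
  proof (rule uniformly_Cauchy_onI)
    fix e :: real assume "0 < e"
    then have "\<forall>\<^sub>F N in sequentially. r N < e" by (rule order_tendstoD(2)[OF r])
    then obtain N where "r N < e" using eventually_happens by fastforce
    then show "\<exists>N. \<forall>x\<in>UNIV. \<forall>m\<ge>N. \<forall>n\<ge>N. dist (cdf (\<mu> k m) x) (cdf (\<mu> k n) x) < e"
      using close[OF k k] unfolding dist_real_def by (meson le_less_trans)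
  qed
  then obtain F where F: "uniform_limit UNIV (\<lambda>n. cdf (\<mu> k n)) F sequentially"
    using Cauchy_uniformly_convergent unfolding uniformly_convergent_on_def by blast
  then obtain \<pi> where \<pi>: "real_distribution \<pi>" "cdf \<pi> = F"
    using uniform_limit_of_cdfs[of "\<mu> k"] dist[OF k] by blast
  have pointwise: "(\<lambda>n. cdf (\<mu> k n) x) \<longlonglongrightarrow> cdf \<pi> x" for x
    unfolding \<pi>(2) by (rule tendsto_uniform_limitI[OF F]) simp
  have "(\<lambda>t. uniform_metric (\<mu> i t) \<pi>) \<longlonglongrightarrow> 0" if i: "i \<in> I" for i
  proof (rule tendsto_sandwich[OF _ _ tendsto_const r])
    show "\<forall>\<^sub>F t in sequentially. 0 \<le> uniform_metric (\<mu> i t) \<pi>"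
      by (intro always_eventually allI uniform_metric_nonneg dist i \<pi>)
    have "\<bar>cdf (\<mu> i t) x - cdf \<pi> x\<bar> \<le> r t" for t x
    proof (rule LIMSEQ_le_const2)
      show "(\<lambda>n. \<bar>cdf (\<mu> i t) x - cdf (\<mu> k n) x\<bar>) \<longlonglongrightarrow> \<bar>cdf (\<mu> i t) x - cdf \<pi> x\<bar>"
        by (intro tendsto_intros pointwise)
    qed (use close[OF i k] in blast)
    then show "\<forall>\<^sub>F t in sequentially. uniform_metric (\<mu> i t) \<pi> \<le> r t"
      by (intro always_eventually allI uniform_metric_le)
  qed
  moreover have "\<pi>' = \<pi>"
    if \<pi>': "real_distribution \<pi>'" and conv: "(\<lambda>t. uniform_metric (\<mu> k t) \<pi>') \<longlonglongrightarrow> 0" for \<pi>'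
  proof (rule cdf_unique[OF \<pi>'(1) \<pi>(1)], rule ext)
    fix x
    have "(\<lambda>n. cdf (\<mu> k n) x - cdf \<pi>' x) \<longlonglongrightarrow> 0"
      by (rule Lim_null_comparison[OF _ conv])
         (auto intro!: always_eventually abs_cdf_diff_le_uniform_metric dist k \<pi>')
    then have "(\<lambda>n. cdf (\<mu> k n) x) \<longlonglongrightarrow> cdf \<pi>' x" by (rule LIM_zero_cancel)
    then show "cdf \<pi>' x = cdf \<pi> x" using pointwise LIMSEQ_unique by blast
  qed
  ultimately show ?thesis using \<pi>(1) k by blast
qed

section \<open>Expectations along a positive Markov chain\<close>

locale positive_markov_chain = prob_space M for M :: "'a measure" +
  fixes S :: "real set" and p :: "real \<Rightarrow> real \<Rightarrow> real" and y :: "nat \<Rightarrow> 'a \<Rightarrow> real"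
  assumes finite_S: "finite S"
    and markov: "markov_chain M S p y"
    and positive: "\<And>e z. e \<in> S \<Longrightarrow> z \<in> S \<Longrightarrow> 0 < p e z"
begin

definition paths :: "nat \<Rightarrow> real list set" where
  "paths t = {h. set h \<subseteq> S \<and> length h = Suc t}"

lemma paths_nonempty: "h \<in> paths t \<Longrightarrow> h \<noteq> []"
  unfolding paths_def by auto

lemma last_path_in_S: "h \<in> paths t \<Longrightarrow> last h \<in> S"
  using paths_nonempty last_in_set unfolding paths_def by blast

lemma finite_paths: "finite (paths t)"
  unfolding paths_def using finite_lists_length_eq[OF finite_S] .

lemma y_measurable [measurable]: "y t \<in> measurable M (count_space S)"
  using markov unfolding markov_chain_def by blast

lemma y_in_S: "\<omega> \<in> space M \<Longrightarrow> y t \<omega> \<in> S"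
  using measurable_space[OF y_measurable] by simp

lemma history_Suc: "history y (Suc t) \<omega> = history y t \<omega> @ [y (Suc t) \<omega>]"
  unfolding history_def by simp

lemma length_history [simp]: "length (history y t \<omega>) = Suc t"
  unfolding history_def by simp

lemma last_history [simp]: "last (history y t \<omega>) = y t \<omega>"
  unfolding history_def by simp

lemma history_in_paths: "\<omega> \<in> space M \<Longrightarrow> history y t \<omega> \<in> paths t"
  unfolding paths_def history_def by (auto simp: y_in_S)

lemma history_event_snoc:
  assumes "h \<noteq> []"
  shows "history_event M y (h @ [z]) = {\<omega> \<in> space M. y (length h) \<omega> = z \<and> history y (length h - 1) \<omega> = h}"
proof -
  obtain t where t: "length h = Suc t" using assms by (cases h) auto
  show ?thesis unfolding history_event_def by (auto simp: t history_Suc)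
qed

text \<open>The state space carries the discrete \<open>\<sigma>\<close>-algebra, so \<open>{z}\<close> is an event only for \<open>z \<in> S\<close>; otherwise
  the preimage is empty.\<close>

lemma y_event_sets: "{\<omega> \<in> space M. y t \<omega> = z} \<in> sets M"
proof (cases "z \<in> S")
  case True
  then have "y t -` {z} \<inter> space M \<in> sets M"
    by (intro measurable_sets[OF y_measurable]) auto
  then show ?thesis by (simp add: vimage_def Int_def conj_commute)
next
  case False
  then have "{\<omega> \<in> space M. y t \<omega> = z} = {}" using y_in_S by blast
  then show ?thesis by (simp only: sets.empty_sets)
qed

lemma history_event_sets [measurable]: "history_event M y h \<in> sets M"
proof (induction h rule: rev_induct)
  case Nil
  have "history_event M y [] = {}"
    unfolding history_event_def history_def by simp
  then show ?case by simp
next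
  case (snoc z h)
  show ?case
  proof (cases "h = []")
    case True
    then show ?thesis using y_event_sets[of 0 z] by (simp add: history_event_def history_def)
  next
    case False
    have "history_event M y (h @ [z]) = {\<omega> \<in> space M. y (length h) \<omega> = z} \<inter> history_event M y h"
      unfolding history_event_snoc[OF False] unfolding history_event_def by auto
    then show ?thesis using snoc y_event_sets[of "length h" z] by auto
  qed
qed

text \<open>The Markov property in product form. It also holds after histories of probability zero, whose
  conditional probabilities the Markov property leaves open, because both sides then vanish.\<close>

lemma prob_history_snoc:
  assumes "h \<noteq> []" "z \<in> S"
  shows "prob (history_event M y (h @ [z])) = prob (history_event M y h) * p (last h) z"
proof (cases "prob (history_event M y h) > 0")
  case True
  then have "\<P>(\<omega> in M. y (length h) \<omega> = z \<bar> history y (length h - 1) \<omega> = h) = p (last h) z"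
    using markov assms unfolding markov_chain_def possible_history_def by blast
  then show ?thesis
    using True unfolding cond_prob_def history_event_snoc[OF assms(1)]
    by (simp add: history_event_def field_simps)
next
  case False
  then have "prob (history_event M y h) = 0" using measure_nonneg[of M] by (metis less_eq_real_def)
  moreover have "prob (history_event M y (h @ [z])) \<le> prob (history_event M y h)"
    unfolding history_event_snoc[OF assms(1)]
    by (rule finite_measure_mono) (auto simp: history_event_def[symmetric], auto simp: history_event_def)
  ultimately show ?thesis using measure_nonneg[of M] by (simp add: order_antisym)
qed

text \<open>A function of the history takes finitely many values, which makes it integrable whatever the
  function is and turns expectations into finite sums over paths.\<close>

lemma history_function_simple:
  fixes G :: "real list \<Rightarrow> real"
  assumes "\<omega> \<in> space M"
  shows "G (history y t \<omega>) = (\<Sum>h\<in>paths t. G h * indicator (history_event M y h) \<omega>)"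
proof -
  have "(\<Sum>h\<in>paths t. G h * indicator (history_event M y h) \<omega>)
      = (\<Sum>h\<in>paths t. if h = history y t \<omega> then G h else 0)"
    using assms by (intro sum.cong) (auto simp: history_event_def paths_def indicator_def)
  also have "\<dots> = G (history y t \<omega>)"
    using history_in_paths[OF assms] finite_paths by simp
  finally show ?thesis by simp
qed

lemma integrable_history:
  fixes G :: "real list \<Rightarrow> real"
  shows "integrable M (\<lambda>\<omega>. G (history y t \<omega>))"
proof -
  have "integrable M (\<lambda>\<omega>. \<Sum>h\<in>paths t. G h * indicator (history_event M y h) \<omega>)"
    by (intro Bochner_Integration.integrable_sum integrable_mult_right) (simp add: less_top[symmetric])
  moreover have "integrable M (\<lambda>\<omega>. G (history y t \<omega>)) \<longleftrightarrow>
      integrable M (\<lambda>\<omega>. \<Sum>h\<in>paths t. G h * indicator (history_event M y h) \<omega>)"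
    by (intro Bochner_Integration.integrable_cong history_function_simple refl)
  ultimately show ?thesis by blast
qed

lemma expectation_history:
  fixes G :: "real list \<Rightarrow> real"
  shows "expectation (\<lambda>\<omega>. G (history y t \<omega>)) = (\<Sum>h\<in>paths t. prob (history_event M y h) * G h)"
proof -
  have "expectation (\<lambda>\<omega>. G (history y t \<omega>))
      = expectation (\<lambda>\<omega>. \<Sum>h\<in>paths t. G h * indicator (history_event M y h) \<omega>)"
    by (intro Bochner_Integration.integral_cong history_function_simple refl)
  also have "\<dots> = (\<Sum>h\<in>paths t. expectation (\<lambda>\<omega>. G h * indicator (history_event M y h) \<omega>))"
    by (intro Bochner_Integration.integral_sum integrable_mult_right) (simp add: less_top[symmetric])
  also have "\<dots> = (\<Sum>h\<in>paths t. prob (history_event M y h) * G h)"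
    by (intro sum.cong refl) (simp add: Int_absorb2[OF sets.sets_into_space[OF history_event_sets]] mult.commute)
  finally show ?thesis .
qed

lemma paths_Suc: "bij_betw (\<lambda>(h, z). h @ [z]) (paths t \<times> S) (paths (Suc t))"
  unfolding bij_betw_def
proof
  show "inj_on (\<lambda>(h, z). h @ [z]) (paths t \<times> S)" by (auto simp: inj_on_def)
  show "(\<lambda>(h, z). h @ [z]) ` (paths t \<times> S) = paths (Suc t)"
  proof (intro equalityI subsetI)
    fix h assume h: "h \<in> paths (Suc t)"
    then have "h \<noteq> []" by (rule paths_nonempty)
    then have eq: "h = butlast h @ [last h]" by simp
    have "last h \<in> S" using h by (rule last_path_in_S)
    moreover have "set (butlast h) \<subseteq> S" using h by (auto simp: paths_def dest: in_set_butlastD)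
    ultimately show "h \<in> (\<lambda>(h, z). h @ [z]) ` (paths t \<times> S)"
      using h eq by (intro image_eqI[of _ _ "(butlast h, last h)"]) (auto simp: paths_def)
  qed (auto simp: paths_def)
qed

lemma expectation_history_step:
  fixes G :: "real list \<Rightarrow> real"
  shows "expectation (\<lambda>\<omega>. G (history y (Suc t) \<omega>))
    = expectation (\<lambda>\<omega>. \<Sum>z\<in>S. p (y t \<omega>) z * G (history y t \<omega> @ [z]))"
proof -
  have "expectation (\<lambda>\<omega>. G (history y (Suc t) \<omega>))
      = (\<Sum>(h, z)\<in>paths t \<times> S. prob (history_event M y (h @ [z])) * G (h @ [z]))"
    unfolding expectation_history sum.reindex_bij_betw[OF paths_Suc, symmetric]
    by (simp add: case_prod_beta)
  also have "\<dots> = (\<Sum>(h, z)\<in>paths t \<times> S. prob (history_event M y h) * (p (last h) z * G (h @ [z])))"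
    by (intro sum.cong refl) (auto simp: prob_history_snoc paths_nonempty)
  also have "\<dots> = (\<Sum>h\<in>paths t. prob (history_event M y h) * (\<Sum>z\<in>S. p (last h) z * G (h @ [z])))"
    by (simp add: sum.cartesian_product[symmetric] sum_distrib_left)
  finally show ?thesis
    using expectation_history[of "\<lambda>h. \<Sum>z\<in>S. p (last h) z * G (h @ [z])" t] by simp
qed

text \<open>The Markov property fixes the row \<open>p e\<close> only when \<open>e\<close> is the end of a history of positive
  probability, and the law of \<open>y 0\<close> may miss \<open>e\<close>. Positive transition probabilities make every state
  reachable at date 1, so that some history \<open>k\<close> of length two ends in \<open>e\<close>; conditioning on \<open>k\<close> then
  shows that the row is a probability vector.\<close>

lemma sum_transition:
  assumes e: "e \<in> S"
  shows "(\<Sum>z\<in>S. p e z) = 1"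
proof -
  have "(\<Sum>h\<in>paths 0. prob (history_event M y h)) = 1"
    using expectation_history[of "\<lambda>_. 1" 0] prob_space by simp
  then obtain h where h: "h \<in> paths 0" "prob (history_event M y h) \<noteq> 0"
    by (metis sum.neutral zero_neq_one)
  have "h \<noteq> []" and "last h \<in> S" using h(1) by (simp_all add: paths_nonempty last_path_in_S)
  define k where "k = h @ [e]"
  have pos: "prob (history_event M y k) \<noteq> 0"
    using prob_history_snoc[OF \<open>h \<noteq> []\<close> e] h(2) positive[OF \<open>last h \<in> S\<close> e] by (simp add: k_def)
  have k: "k \<noteq> []" "last k = e" "k \<in> paths 1" using h(1) e by (auto simp: k_def paths_def)
  have delta: "(\<Sum>l\<in>paths 1. prob (history_event M y l) * (of_bool (l = k) * c l))
      = prob (history_event M y k) * c k" for c :: "real list \<Rightarrow> real"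
  proof -
    have "(\<Sum>l\<in>paths 1. prob (history_event M y l) * (of_bool (l = k) * c l))
      = (\<Sum>l\<in>paths 1. if l = k then prob (history_event M y k) * c k else 0)"
      by (intro sum.cong) auto
    then show ?thesis using k(3) finite_paths by simp
  qed
  have "prob (history_event M y k) = expectation (\<lambda>\<omega>. of_bool (history y 1 \<omega> = k))"
    using expectation_history[of "\<lambda>l. of_bool (l = k)" 1] delta[of "\<lambda>_. 1"] by simp
  also have "\<dots> = expectation (\<lambda>\<omega>. of_bool (butlast (history y (Suc 1) \<omega>) = k))"
    by (simp add: history_Suc butlast_append)
  also have "\<dots> = expectation (\<lambda>\<omega>. \<Sum>z\<in>S. p (y 1 \<omega>) z * of_bool (history y 1 \<omega> = k))"
    using expectation_history_step[of "\<lambda>l. of_bool (butlast l = k)" 1] by simp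
  also have "\<dots> = expectation (\<lambda>\<omega>. of_bool (history y 1 \<omega> = k) * (\<Sum>z\<in>S. p (last (history y 1 \<omega>)) z))"
    by (simp add: sum_distrib_right mult.commute[of "of_bool _"])
  also have "\<dots> = prob (history_event M y k) * (\<Sum>z\<in>S. p e z)"
    unfolding expectation_history[of "\<lambda>l. of_bool (l = k) * (\<Sum>z\<in>S. p (last l) z)"] delta k(2) ..
  finally show ?thesis using pos by simp
qed

section \<open>Contraction and the law of consumption\<close>

text \<open>The transition operator of the pair \<open>(c\<^sub>t, y\<^sub>t)\<close>, acting on functions of the two variables.\<close>

definition expected_next ::
  "(real \<Rightarrow> real \<Rightarrow> real) \<Rightarrow> (real \<Rightarrow> real \<Rightarrow> real) \<Rightarrow> real \<Rightarrow> real \<Rightarrow> real" where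
  "expected_next f g c e = (\<Sum>z\<in>S. p e z * g (f c z) z)"

lemma expected_next_bounds:
  assumes invariant: "\<And>c z. c \<in> K \<Longrightarrow> z \<in> S \<Longrightarrow> f c z \<in> K"
    and bounds: "\<And>c e. c \<in> K \<Longrightarrow> e \<in> S \<Longrightarrow> g c e \<in> {a..b}"
    and "c \<in> K" "e \<in> S"
  shows "expected_next f g c e \<in> {a..b}"
proof -
  have "(\<Sum>z\<in>S. p e z * a) \<le> expected_next f g c e" "expected_next f g c e \<le> (\<Sum>z\<in>S. p e z * b)"
    unfolding expected_next_def using assms positive
    by (auto intro!: sum_mono mult_left_mono simp: less_imp_le)
  then show ?thesis using sum_transition[OF \<open>e \<in> S\<close>] by (simp flip: sum_distrib_right)
qed

text \<open>With the term of the resetting state \<open>z0\<close> split off, the average is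
  \<open>p e z0 * v\<close> plus a part of weight \<open>1 - p e z0\<close> with values between \<open>a\<close> and \<open>b\<close>, where
  \<open>v = g k z0\<close> depends on neither \<open>c\<close> nor \<open>e\<close>. Weight \<open>\<delta>\<close> is thus
  placed on a common value, and the length of the interval drops from \<open>b - a\<close> to
  \<open>(1 - \<delta>) * (b - a)\<close>.\<close>

lemma expected_next_contracts:
  assumes invariant: "\<And>c z. c \<in> K \<Longrightarrow> z \<in> S \<Longrightarrow> f c z \<in> K"
    and reset: "\<And>c. c \<in> K \<Longrightarrow> f c z0 = k" "z0 \<in> S" "k \<in> K"
    and \<delta>: "\<And>e. e \<in> S \<Longrightarrow> \<delta> \<le> p e z0"
    and bounds: "\<And>c e. c \<in> K \<Longrightarrow> e \<in> S \<Longrightarrow> g c e \<in> {a..b}"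
    and "c \<in> K" "e \<in> S"
  shows "expected_next f g c e \<in> {a + \<delta> * (g k z0 - a) .. b - \<delta> * (b - g k z0)}"
proof -
  have split: "(\<Sum>z\<in>S. p e z * q z) = p e z0 * q z0 + (\<Sum>z\<in>S - {z0}. p e z * q z)" for q
    using sum.remove[OF finite_S reset(2)] .
  have rest: "(\<Sum>z\<in>S - {z0}. p e z) = 1 - p e z0"
    using split[of "\<lambda>_. 1"] sum_transition[OF \<open>e \<in> S\<close>] by simp
  have "(\<Sum>z\<in>S - {z0}. p e z * a) \<le> (\<Sum>z\<in>S - {z0}. p e z * g (f c z) z)"
    "(\<Sum>z\<in>S - {z0}. p e z * g (f c z) z) \<le> (\<Sum>z\<in>S - {z0}. p e z * b)"
    using assms positive by (auto intro!: sum_mono mult_left_mono simp: less_imp_le)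
  then have "p e z0 * g k z0 + (1 - p e z0) * a \<le> expected_next f g c e"
    "expected_next f g c e \<le> p e z0 * g k z0 + (1 - p e z0) * b"
    unfolding expected_next_def split reset(1)[OF \<open>c \<in> K\<close>]
    by (simp_all add: rest flip: sum_distrib_right)
  moreover have "\<delta> * (g k z0 - a) \<le> p e z0 * (g k z0 - a)" "\<delta> * (b - g k z0) \<le> p e z0 * (b - g k z0)"
    using \<delta>[OF \<open>e \<in> S\<close>] bounds[OF reset(3,2)] by (auto intro!: mult_right_mono)
  ultimately show ?thesis by (auto simp: algebra_simps)
qed

text \<open>The bounds at \<open>N\<close> come from \<open>N\<close> contractions; averaging cannot leave an
  interval, so the same bounds persist for all later iterates. This persistence is what makes
  distribution functions at different dates comparable.\<close>

lemma expected_next_iterates_contract: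
  assumes invariant: "\<And>c z. c \<in> K \<Longrightarrow> z \<in> S \<Longrightarrow> f c z \<in> K"
    and reset: "\<And>c. c \<in> K \<Longrightarrow> f c z0 = k" "z0 \<in> S" "k \<in> K"
    and \<delta>: "\<And>e. e \<in> S \<Longrightarrow> \<delta> \<le> p e z0"
    and bounds: "\<And>c e. c \<in> K \<Longrightarrow> e \<in> S \<Longrightarrow> g c e \<in> {0..1}"
  shows "\<exists>a b. b - a = (1 - \<delta>) ^ N \<and>
    (\<forall>n\<ge>N. \<forall>c\<in>K. \<forall>e\<in>S. (expected_next f ^^ n) g c e \<in> {a..b})"
proof -
  have "\<exists>a b. b - a = (1 - \<delta>) ^ N \<and> (\<forall>c\<in>K. \<forall>e\<in>S. (expected_next f ^^ N) g c e \<in> {a..b})"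
  proof (induction N)
    case 0
    show ?case using bounds by (intro exI[of _ 0] exI[of _ 1]) auto
  next
    case (Suc N)
    then obtain a b where ab: "b - a = (1 - \<delta>) ^ N"
      "\<And>c e. c \<in> K \<Longrightarrow> e \<in> S \<Longrightarrow> (expected_next f ^^ N) g c e \<in> {a..b}" by blast
    let ?v = "(expected_next f ^^ N) g k z0"
    have "(b - \<delta> * (b - ?v)) - (a + \<delta> * (?v - a)) = (1 - \<delta>) * (b - a)"
      by (simp add: algebra_simps)
    moreover have "\<forall>c\<in>K. \<forall>e\<in>S. (expected_next f ^^ Suc N) g c e
        \<in> {a + \<delta> * (?v - a) .. b - \<delta> * (b - ?v)}"
      using expected_next_contracts[of K f z0 k \<delta> "(expected_next f ^^ N) g" a b,
          OF invariant reset \<delta> ab(2)] by simp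
    ultimately show ?case unfolding ab(1) power_Suc by blast
  qed
  then obtain a b where ab: "b - a = (1 - \<delta>) ^ N"
    "\<forall>c\<in>K. \<forall>e\<in>S. (expected_next f ^^ N) g c e \<in> {a..b}" by blast
  have "\<forall>c\<in>K. \<forall>e\<in>S. (expected_next f ^^ n) g c e \<in> {a..b}" if "N \<le> n" for n
    using that
  proof (induction n rule: dec_induct)
    case base
    show ?case by (rule ab(2))
  next
    case (step n)
    then show ?case
      using expected_next_bounds[of K f "(expected_next f ^^ n) g" a b] invariant by simp
  qed
  then show ?thesis using ab(1) by blast
qed

lemma consumption_history:
  "consumption lo hi y c0 t \<omega> = foldl (next_consumption lo hi) c0 (tl (history y t \<omega>))"
proof (induction t)
  case 0
  show ?case by (simp add: history_def)
next
  case (Suc t)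
  have "history y t \<omega> \<noteq> []" using length_history[of t \<omega>] by (metis Zero_not_Suc list.size(3))
  then show ?case using Suc by (simp add: history_Suc)
qed

lemma integrable_consumption:
  fixes g :: "real \<Rightarrow> real \<Rightarrow> real"
  shows "integrable M (\<lambda>\<omega>. g (consumption lo hi y c0 t \<omega>) (y t \<omega>))"
  using integrable_history[of "\<lambda>h. g (foldl (next_consumption lo hi) c0 (tl h)) (last h)" t]
  by (simp add: consumption_history)

text \<open>The induction peels off the last date, at which the conditional expectation given the history
  is \<open>expected_next\<close> of the test function; hence the generalisation over \<open>g\<close>.\<close>

lemma expectation_consumption:
  "expectation (\<lambda>\<omega>. g (consumption lo hi y c0 t \<omega>) (y t \<omega>))
    = expectation (\<lambda>\<omega>. (expected_next (next_consumption lo hi) ^^ t) g c0 (y 0 \<omega>))"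
proof (induction t arbitrary: g)
  case 0
  show ?case by simp
next
  case (Suc t)
  have ne: "history y t \<omega> \<noteq> []" for \<omega> using length_history[of t \<omega>] by (metis Zero_not_Suc list.size(3))
  have "expectation (\<lambda>\<omega>. g (consumption lo hi y c0 (Suc t) \<omega>) (y (Suc t) \<omega>))
      = expectation (\<lambda>\<omega>. expected_next (next_consumption lo hi) g (consumption lo hi y c0 t \<omega>) (y t \<omega>))"
    using expectation_history_step[of "\<lambda>h. g (foldl (next_consumption lo hi) c0 (tl h)) (last h)" t]
    unfolding consumption_history by (simp add: ne expected_next_def)
  also have "\<dots> = expectation (\<lambda>\<omega>.
      (expected_next (next_consumption lo hi) ^^ t) (expected_next (next_consumption lo hi) g) c0 (y 0 \<omega>))"
    by (rule Suc)
  finally show ?case by (simp add: funpow_Suc_right del: funpow.simps)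
qed

lemma consumption_measurable [measurable]: "consumption lo hi y c0 t \<in> borel_measurable M"
  using borel_measurable_integrable[OF integrable_consumption[of "\<lambda>c _. c"]] by simp

lemma cdf_consumption:
  "cdf (distr M borel (consumption lo hi y c0 t)) x
    = expectation (\<lambda>\<omega>. (expected_next (next_consumption lo hi) ^^ t) (\<lambda>c _. of_bool (c \<le> x)) c0 (y 0 \<omega>))"
proof -
  have "cdf (distr M borel (consumption lo hi y c0 t)) x
      = prob {\<omega> \<in> space M. consumption lo hi y c0 t \<omega> \<le> x}"
    unfolding cdf_def by (subst measure_distr) (auto simp: vimage_def Int_def conj_commute)
  also have "\<dots> = expectation (indicator {\<omega> \<in> space M. consumption lo hi y c0 t \<omega> \<le> x})"
    by simp
  also have "\<dots> = expectation (\<lambda>\<omega>. of_bool (consumption lo hi y c0 t \<omega> \<le> x))"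
    by (intro Bochner_Integration.integral_cong) (auto simp: indicator_def)
  finally show ?thesis
    using expectation_consumption[of "\<lambda>c _. of_bool (c \<le> x)"] by simp
qed

text \<open>Each of the two distribution functions is an average over \<open>y 0\<close> of an iterate of
  \<open>expected_next\<close> of order at least \<open>N\<close>, started in \<open>K\<close>, so both lie in the same interval of length
  \<open>(1 - \<delta>) ^ N\<close>.\<close>

lemma cdf_consumption_close:
  assumes invariant: "\<And>c z. c \<in> K \<Longrightarrow> z \<in> S \<Longrightarrow> next_consumption lo hi c z \<in> K"
    and reset: "\<And>c. c \<in> K \<Longrightarrow> next_consumption lo hi c z0 = k" "z0 \<in> S" "k \<in> K"
    and \<delta>: "\<And>e. e \<in> S \<Longrightarrow> \<delta> \<le> p e z0"
    and start: "c1 \<in> K" "c2 \<in> K" and late: "N \<le> s" "N \<le> t"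
  shows "\<bar>cdf (distr M borel (consumption lo hi y c1 s)) x
    - cdf (distr M borel (consumption lo hi y c2 t)) x\<bar> \<le> (1 - \<delta>) ^ N"
proof -
  let ?T = "expected_next (next_consumption lo hi)" and ?g = "\<lambda>c (_::real). of_bool (c \<le> x) :: real"
  have "?g c e \<in> {0..1}" for c e by simp
  then obtain a b where ab: "b - a = (1 - \<delta>) ^ N"
    "\<And>n c e. N \<le> n \<Longrightarrow> c \<in> K \<Longrightarrow> e \<in> S \<Longrightarrow> (?T ^^ n) ?g c e \<in> {a..b}"
    using expected_next_iterates_contract[of K "next_consumption lo hi" z0 k \<delta> ?g N,
        OF invariant reset \<delta>] by blast
  have "cdf (distr M borel (consumption lo hi y c n)) x \<in> {a..b}" if "N \<le> n" "c \<in> K" for n c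
  proof -
    have "integrable M (\<lambda>\<omega>. (?T ^^ n) ?g c (y 0 \<omega>))"
      using integrable_history[of "\<lambda>h. (?T ^^ n) ?g c (last h)" 0] by simp
    then show ?thesis
      unfolding cdf_consumption using ab(2)[OF that] y_in_S[of _ 0]
      by (auto intro!: integral_ge_const integral_le_const AE_I2)
  qed
  from this[OF late(1) start(1)] this[OF late(2) start(2)] show ?thesis
    using ab(1) by auto
qed

end

section \<open>Convergence to a unique distribution\<close>

theorem mainTheorem5:
  fixes M :: "'a measure" and S :: "real set" and p :: "real \<Rightarrow> real \<Rightarrow> real"
    and y :: "nat \<Rightarrow> 'a \<Rightarrow> real" and u :: "real \<Rightarrow> real" and \<beta> Y :: real
    and lo hi :: "real \<Rightarrow> real" and c_min c_max :: real
  assumes model: "risk_sharing_model M S p y u \<beta> Y"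
    and positive: "\<forall>e\<in>S. \<forall>e'\<in>S. p e e' > 0"
    and intervals: "solution_intervals M S y u \<beta> Y lo hi"
    and c_min: "c_min = Min (hi ` S)"
    and c_max: "c_max = Max (lo ` S)"
    and not_first_best: "\<not> first_best_sustainable M S y u \<beta> Y"
  shows "c_min < c_max \<and>
    (\<exists>!\<pi>. real_distribution \<pi> \<and>
       (\<forall>c0\<in>{c_min..c_max}.
          (\<lambda>t. uniform_metric (distr M borel (consumption lo hi y c0 t)) \<pi>) \<longlonglongrightarrow> 0))"
proof
  have fin: "finite S" and ne: "S \<noteq> {}" and chain: "markov_chain M S p y"
    using model unfolding risk_sharing_model_def by auto
  have hi: "c_min \<le> hi z" and lo: "lo z \<le> c_max" if "z \<in> S" for z
    using that fin by (auto simp: c_min c_max)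
  have "(\<Inter>z\<in>S. {lo z..hi z}) = {}"
    using intervals not_first_best unfolding solution_intervals_def by blast
  \<comment> \<open>If the ends do not cross, \<open>c_min\<close> belongs to every interval.\<close>
  moreover have "c_min \<in> (\<Inter>z\<in>S. {lo z..hi z})" if "c_max \<le> c_min"
    using that hi lo by (auto intro: order_trans)
  ultimately show less: "c_min < c_max" by fastforce

  interpret positive_markov_chain M S p y
    using chain fin positive
    by (auto simp: positive_markov_chain_def positive_markov_chain_axioms_def markov_chain_def)
  have "c_min \<in> hi ` S" unfolding c_min using fin ne by (intro Min_in) auto
  then obtain z0 where z0: "z0 \<in> S" "hi z0 = c_min" by auto
  have lo_hi: "lo z0 \<le> hi z0"
    using intervals z0(1) unfolding solution_intervals_def by blast
  define \<delta> where "\<delta> = Min ((\<lambda>e. p e z0) ` S)"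
  have \<delta>_le: "\<delta> \<le> p e z0" if "e \<in> S" for e
    unfolding \<delta>_def using fin that by simp
  have "0 < \<delta>" unfolding \<delta>_def using fin ne z0(1) positive by simp
  have "p z0 z0 \<le> (\<Sum>z\<in>S. p z0 z)"
    using z0(1) fin positive by (intro member_le_sum) (auto simp: less_imp_le)
  then have "\<delta> \<le> 1" using \<delta>_le[OF z0(1)] sum_transition[OF z0(1)] by linarith
  have invariant: "next_consumption lo hi c z \<in> {c_min..c_max}" if "c \<in> {c_min..c_max}" "z \<in> S" for c z
    using that hi[OF that(2)] lo[OF that(2)] unfolding next_consumption_def by auto
  have reset: "next_consumption lo hi c z0 = c_min" if "c \<in> {c_min..c_max}" for c
    using that z0(2) lo_hi unfolding next_consumption_def by auto
  show "\<exists>!\<pi>. real_distribution \<pi> \<and>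
       (\<forall>c0\<in>{c_min..c_max}.
          (\<lambda>t. uniform_metric (distr M borel (consumption lo hi y c0 t)) \<pi>) \<longlonglongrightarrow> 0)"
  proof (rule common_uniform_limit)
    show "{c_min..c_max} \<noteq> {}" using less by simp
    show "(\<lambda>N. (1 - \<delta>) ^ N) \<longlonglongrightarrow> 0"
      using \<open>0 < \<delta>\<close> \<open>\<delta> \<le> 1\<close> by (intro LIMSEQ_power_zero) auto
    show "real_distribution (distr M borel (consumption lo hi y c t))" for c t
      by simp
    show "\<bar>cdf (distr M borel (consumption lo hi y c1 s)) x
        - cdf (distr M borel (consumption lo hi y c2 t)) x\<bar> \<le> (1 - \<delta>) ^ N"
      if "c1 \<in> {c_min..c_max}" "c2 \<in> {c_min..c_max}" "N \<le> s" "N \<le> t" for N c1 c2 s t x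
      by (rule cdf_consumption_close[OF invariant reset z0(1) _ \<delta>_le that]) (use less in auto)
  qed
qed

end
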